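(* Let $\mathcal{C}$ be a class of finite simple undirected graphs. Then $\mathcal{C}$ is both weakly sparse and strongly flip-flat if and only if $\mathcal{C}$ is uniformly almost-wide.
   Context: $\mathbb{N}$ denotes the positive integers. For a graph $G$ and $S\subseteq V(G)$, $G\setminus S$ is the subgraph induced by $V(G)\setminus S$. A set $B\subseteq V(G)$ is $r$-independent in $G$ if every two distinct vertices of $B$ are at distance strictly greater than $r$ in $G$. $K_{t,t}$ is the complete bipartite graph with $t$ vertices on each side. A class $\mathcal{C}$ is weakly sparse if there is $t\in\mathbb{N}$ such that no graph of $\mathcal{C}$ contains $K_{t,t}$ as a subgraph. A flip in $G$ is a pair $F=(A,B)$ of subsets of $V(G)$ (possibly intersecting or equal); $G\oplus F$ is the graph on $V(G)$ whose edge set is $E(G)\,\Delta\,((A\times B)\cup(B\times A))$ (i.e. adjacency between every vertex of $A$ and every other vertex of $B$ is complemented). For a set of flips $\mathcal{F}=\{F_1,\dots,F_k\}$, $G\oplus\mathcal{F}=G\oplus F_1\oplus\cdots\oplus F_k$. $\mathcal{C}$ is strongly flip-flat if there is an integer $s$ such that for every $r\in\mathbb{N}$ there is a function $N_r:\mathbb{N}\to\mathbb{N}$ such that for all $m\in\mathbb{N}$, all $G\in\mathcal{C}$ and all $A\subseteq V(G)$ with $|A|\ge N_r(m)$, there are a set of flips $\mathcal{F}$ with $|\mathcal{F}|\le s$ and $B\subseteq A$ with $|B|\ge m$ such that $B$ is $r$-independent in $G\oplus\mathcal{F}$. $\mathcal{C}$ is uniformly almost-wide if there is an integer $s$ such that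 for every $r\in\mathbb{N}$ there is a function $N_r:\mathbb{N}\to\mathbb{N}$ such that for all $m\in\mathbb{N}$, all $G\in\mathcal{C}$ and all $A\subseteq V(G)$ with $|A|\ge N_r(m)$, there are $S\subseteq V(G)$ with $|S|\le s$ and $B\subseteq A\setminus S$ with $|B|> m$ such that $B$ is $r$-independent in $G\setminus S$. *)

theory Defs
  imports "Graph_Theory.Graph_Theory"
begin

text \<open>
  A finite simple undirected graph is a \<open>pair_pre_digraph\<close> satisfying \<open>pair_graph\<close>: the arc set is
  a finite, symmetric, irreflexive relation on a finite vertex set. The positive integers are
  rendered as the subset \<open>{1..}\<close> of the type \<open>nat\<close>.
\<close>

text \<open>The distance is \<open>\<infinity>\<close> for vertices in different components.\<close>

definition graph_dist :: "('a, 'b) pre_digraph \<Rightarrow> 'a \<Rightarrow> 'a \<Rightarrow> ereal" where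
  "graph_dist G u v = wf_digraph.\<mu> G (\<lambda>_. 1) u v"

definition r_independent :: "nat \<Rightarrow> ('a, 'b) pre_digraph \<Rightarrow> 'a set \<Rightarrow> bool" where
  "r_independent r G B \<longleftrightarrow>
     B \<subseteq> verts G \<and> (\<forall>u\<in>B. \<forall>v\<in>B. u \<noteq> v \<longrightarrow> graph_dist G u v > ereal (real r))"

definition delete_verts :: "('a, 'b) pre_digraph \<Rightarrow> 'a set \<Rightarrow> ('a, 'b) pre_digraph" where
  "delete_verts G S = G \<restriction> (verts G - S)"

definition weakly_sparse :: "'a pair_pre_digraph set \<Rightarrow> bool" where
  "weakly_sparse \<C> \<longleftrightarrow>
     (\<exists>t\<ge>1. \<forall>G\<in>\<C>. \<not> (\<exists>H. subgraph H (with_proj G) \<and> complete_bipartite_digraph t t H))"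

definition is_flip :: "'a pair_pre_digraph \<Rightarrow> 'a set \<times> 'a set \<Rightarrow> bool" where
  "is_flip G F \<longleftrightarrow> fst F \<subseteq> pverts G \<and> snd F \<subseteq> pverts G"

text \<open>The diagonal is removed because only pairs of distinct vertices are complemented, also when
  the two sides of the flip intersect.\<close>

definition flip :: "'a set \<times> 'a set \<Rightarrow> 'a pair_pre_digraph \<Rightarrow> 'a pair_pre_digraph" where
  "flip F G = G\<lparr> parcs := sym_diff (parcs G) ((fst F \<times> snd F \<union> snd F \<times> fst F) - Id) \<rparr>"

text \<open>Applies the flips of a finite set one after another; by \<open>comp_fun_commute_flip\<close> below the
  order is irrelevant.\<close>

definition flips :: "('a set \<times> 'a set) set \<Rightarrow> 'a pair_pre_digraph \<Rightarrow> 'a pair_pre_digraph" where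
  "flips \<F> G = Finite_Set.fold flip G \<F>"

definition strongly_flip_flat :: "'a pair_pre_digraph set \<Rightarrow> bool" where
  "strongly_flip_flat \<C> \<longleftrightarrow>
     (\<exists>s::nat. \<forall>r\<ge>1. \<exists>N \<in> {1::nat..} \<rightarrow> {1::nat..}. \<forall>m\<ge>1. \<forall>G\<in>\<C>. \<forall>A\<subseteq>pverts G.
        card A \<ge> N m \<longrightarrow>
        (\<exists>\<F> B. finite \<F> \<and> card \<F> \<le> s \<and> (\<forall>F\<in>\<F>. is_flip G F) \<and>
               B \<subseteq> A \<and> card B \<ge> m \<and> r_independent r (with_proj (flips \<F> G)) B))"

definition uniformly_almost_wide :: "'a pair_pre_digraph set \<Rightarrow> bool" where
  "uniformly_almost_wide \<C> \<longleftrightarrow>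
     (\<exists>s::nat. \<forall>r\<ge>1. \<exists>N \<in> {1::nat..} \<rightarrow> {1::nat..}. \<forall>m\<ge>1. \<forall>G\<in>\<C>. \<forall>A\<subseteq>pverts G.
        card A \<ge> N m \<longrightarrow>
        (\<exists>S B. S \<subseteq> pverts G \<and> card S \<le> s \<and>
               B \<subseteq> A - S \<and> card B > m \<and> r_independent r (delete_verts (with_proj G) S) B))"

lemma comp_fun_commute_flip: "comp_fun_commute flip"
proof
  fix F F' :: "'a set \<times> 'a set"
  have "sym_diff (sym_diff E X) Y = sym_diff (sym_diff E Y) X" for E X Y :: "'a rel"
    by blast
  then show "flip F' \<circ> flip F = flip F \<circ> flip F'"
    by (simp add: flip_def fun_eq_iff)
qed

lemma flips_empty [simp]: "flips {} G = G"
  by (simp add: flips_def)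

lemma flips_insert:
  assumes "finite \<F>" "F \<notin> \<F>"
  shows "flips (insert F \<F>) G = flip F (flips \<F> G)"
  using assms by (simp add: flips_def comp_fun_commute_on.fold_insert
      [OF comp_fun_commute_flip[unfolded comp_fun_commute_def']])

lemma pverts_flip [simp]: "pverts (flip F G) = pverts G"
  by (simp add: flip_def)

lemma pair_graph_flip:
  assumes "pair_graph G" "is_flip G F"
  shows "pair_graph (flip F G)"
proof -
  interpret pair_graph G by fact
  have V: "fst F \<subseteq> pverts G" "snd F \<subseteq> pverts G"
    using assms(2) by (auto simp: is_flip_def)
  have sub: "parcs (flip F G) \<subseteq> pverts G \<times> pverts G"
    using V by (auto simp: flip_def dest: wellformed')
  have "finite (parcs (flip F G))"
    using sub finite_subset pair_finite_verts by blast
  moreover have "sym (parcs (flip F G))"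
    using pair_sym_arcs by (auto simp: flip_def symmetric_def sym_def)
  moreover have "fst e \<noteq> snd e" if "e \<in> parcs (flip F G)" for e
    using that pair_no_loops by (auto simp: flip_def)
  ultimately show ?thesis
    using sub pair_finite_verts by unfold_locales (auto simp: symmetric_def)
qed

lemma pair_graph_flips:
  assumes "finite \<F>" "pair_graph G" "\<forall>F\<in>\<F>. is_flip G F"
  shows "pair_graph (flips \<F> G) \<and> pverts (flips \<F> G) = pverts G"
  using assms
  by (induction \<F> rule: finite_induct)
     (auto simp: flips_insert is_flip_def intro!: pair_graph_flip)

lemma graph_dist_eq:
  assumes "wf_digraph G"
  shows "graph_dist G u v = (INF p\<in>{p. pre_digraph.awalk G u p v}. ereal (real (length p)))"
  using assms
  by (simp add: graph_dist_def wf_digraph.\<mu>_def wf_digraph.awalk_cost_def sum_list_triv)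

end

theory Submission
  imports Defs
begin

text \<open>
  At most \<open>s\<close> flips split the vertices into at most \<open>4 ^ s\<close> classes such that between two classes
  the adjacency is either kept or complemented as a whole. Let \<open>B\<close> be \<open>(2 r + 2)\<close>-independent in
  the flipped graph and, by pigeonhole, such that the \<open>r\<close>-balls around its points meet the same
  classes. If such a class is complemented against a class \<open>Y\<close>, its representatives in the disjoint
  balls are adjacent in \<open>G\<close> to almost all of \<open>Y\<close> (every vertex of \<open>Y\<close> misses at most two of them),
  so excluding \<open>K\<^bsub>t,t\<^esub>\<close> forces \<open>Y\<close> to have fewer than \<open>t\<close> vertices. Hence after deleting all classes
  with fewer than \<open>t\<close> vertices, at most \<open>t * 4 ^ s\<close> vertices whatever \<open>r\<close> is, walks of length at
  most \<open>r\<close> starting in \<open>B\<close> are walks of the flipped graph. Conversely, a deleted set is simulated by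
  flips that cut off its vertices one by one, and two vertices on one side of a large biclique stay at
  distance two after few deletions.
\<close>

section \<open>Walks and bicliques\<close>

text \<open>Expressing walk lengths by powers of the arc relation makes concatenation and reversal
  of walks plain relation algebra. The condition on \<open>u\<close> matters at length zero: the
  zeroth power is the identity on the whole type, while a trivial walk has to sit at a
  vertex.\<close>

lemma awalk_relpow_iff:
  assumes "wf_digraph G"
  shows "(\<exists>p. pre_digraph.awalk G u p v \<and> length p = n) \<longleftrightarrow> u \<in> verts G \<and> (u, v) \<in> arcs_ends G ^^ n"
proof -
  interpret wf_digraph G by fact
  show ?thesis
  proof (induction n arbitrary: u)
    case 0
    show ?case by (auto simp: awalk_Nil_iff)
  next
    case (Suc n)
    have "(\<exists>p. awalk u p v \<and> length p = Suc n) \<longleftrightarrow>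
        (\<exists>e\<in>arcs G. u = tail G e \<and> (\<exists>p. awalk (head G e) p v \<and> length p = n))"
    proof safe
      fix p assume "awalk u p v" "length p = Suc n"
      then obtain e q where "p = e # q" "length q = n" by (auto simp: length_Suc_conv)
      with \<open>awalk u p v\<close> show "\<exists>e\<in>arcs G. u = tail G e \<and> (\<exists>p. awalk (head G e) p v \<and> length p = n)"
        by (auto simp: awalk_Cons_iff)
    next
      fix e p assume "e \<in> arcs G" "awalk (head G e) p v" "n = length p"
      then show "\<exists>q. awalk (tail G e) q v \<and> length q = Suc (length p)"
        by (intro exI[of _ "e # p"]) (simp add: awalk_Cons_iff)
    qed
    also have "\<dots> \<longleftrightarrow> (\<exists>e\<in>arcs G. u = tail G e \<and> (head G e, v) \<in> arcs_ends G ^^ n)"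
      using Suc.IH by auto
    also have "\<dots> \<longleftrightarrow> u \<in> verts G \<and> (u, v) \<in> arcs_ends G ^^ Suc n"
    proof -
      have "(u, v) \<in> arcs_ends G ^^ Suc n \<longleftrightarrow> (\<exists>w. (u, w) \<in> arcs_ends G \<and> (w, v) \<in> arcs_ends G ^^ n)"
        by (meson relpow_Suc_D2 relpow_Suc_I2)
      moreover have "(u, w) \<in> arcs_ends G \<longleftrightarrow> (\<exists>e\<in>arcs G. u = tail G e \<and> w = head G e)" for w
        by (auto simp: arcs_ends_conv)
      ultimately show ?thesis by auto
    qed
    finally show ?case .
  qed
qed

lemma graph_dist_gt_iff:
  assumes "wf_digraph G" "u \<in> verts G"
  shows "graph_dist G u v > ereal (real r) \<longleftrightarrow> (\<forall>n\<le>r. (u, v) \<notin> arcs_ends G ^^ n)"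
proof
  assume gt: "graph_dist G u v > ereal (real r)"
  show "\<forall>n\<le>r. (u, v) \<notin> arcs_ends G ^^ n"
  proof (intro allI impI notI)
    fix n assume "n \<le> r" "(u, v) \<in> arcs_ends G ^^ n"
    then obtain p where "pre_digraph.awalk G u p v" "length p = n"
      using awalk_relpow_iff[OF assms(1)] assms(2) by blast
    then have "graph_dist G u v \<le> ereal (real n)"
      unfolding graph_dist_eq[OF assms(1)] by (auto intro!: INF_lower2)
    with gt have "ereal (real r) < ereal (real n)"
      by (rule less_le_trans)
    with \<open>n \<le> r\<close> show False by simp
  qed
next
  assume far: "\<forall>n\<le>r. (u, v) \<notin> arcs_ends G ^^ n"
  \<comment> \<open>An infimum preserves only non-strict bounds. Walk lengths are integers, so
    exceeding \<open>r\<close> is the same as being at least \<open>Suc r\<close>, and this bound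
    passes to the distance, also when there is no walk at all.\<close>
  have "ereal (real (Suc r)) \<le> ereal (real (length p))" if "pre_digraph.awalk G u p v" for p
    using far that awalk_relpow_iff[OF assms(1), of u v "length p"]
    by (metis ereal_less_eq(3) not_less_eq_eq of_nat_le_iff)
  then have "ereal (real (Suc r)) \<le> graph_dist G u v"
    unfolding graph_dist_eq[OF assms(1)] by (auto intro!: INF_greatest)
  moreover have "ereal (real r) < ereal (real (Suc r))" by simp
  ultimately show "graph_dist G u v > ereal (real r)"
    by (rule less_le_trans[rotated])
qed

lemma r_independent_iff:
  assumes "wf_digraph G"
  shows "r_independent r G B \<longleftrightarrow>
    B \<subseteq> verts G \<and> (\<forall>u\<in>B. \<forall>v\<in>B. u \<noteq> v \<longrightarrow> (\<forall>n\<le>r. (u, v) \<notin> arcs_ends G ^^ n))"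
  using graph_dist_gt_iff[OF assms] unfolding r_independent_def by blast

lemma r_independent_pair_iff:
  assumes "pair_graph G"
  shows "r_independent r (with_proj G) B \<longleftrightarrow>
    B \<subseteq> pverts G \<and> (\<forall>u\<in>B. \<forall>v\<in>B. u \<noteq> v \<longrightarrow> (\<forall>n\<le>r. (u, v) \<notin> parcs G ^^ n))"
proof -
  interpret pair_graph G by fact
  show ?thesis
    using r_independent_iff[OF wf_digraph_axioms] by simp
qed

lemma r_independent_delete_verts_iff:
  assumes "pair_graph G"
  shows "r_independent r (delete_verts (with_proj G) S) B \<longleftrightarrow>
    B \<subseteq> pverts G - S \<and> (\<forall>u\<in>B. \<forall>v\<in>B. u \<noteq> v \<longrightarrow>
      (\<forall>n\<le>r. (u, v) \<notin> (parcs G \<inter> (pverts G - S) \<times> (pverts G - S)) ^^ n))"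
proof -
  have wf: "wf_digraph (delete_verts (with_proj G) S)"
    by unfold_locales (auto simp: delete_verts_def)
  have "arcs_ends (delete_verts (with_proj G) S) = parcs G \<inter> (pverts G - S) \<times> (pverts G - S)"
    by (auto simp: delete_verts_def arcs_ends_conv image_iff)
  then show ?thesis
    using r_independent_iff[OF wf] by (simp add: delete_verts_def)
qed

text \<open>One rectangle of arcs encodes a complete bipartite subgraph: in a symmetric loopless
  graph the reversed arcs and the disjointness of the two sides follow from it.\<close>

definition biclique :: "nat \<Rightarrow> 'a pair_pre_digraph \<Rightarrow> 'a set \<Rightarrow> 'a set \<Rightarrow> bool" where
  "biclique t G U V \<longleftrightarrow>
     U \<subseteq> pverts G \<and> V \<subseteq> pverts G \<and> card U = t \<and> card V = t \<and> U \<times> V \<subseteq> parcs G"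

lemma contains_complete_bipartite_iff:
  assumes "pair_graph G"
  shows "(\<exists>H. subgraph H (with_proj G) \<and> complete_bipartite_digraph t t H) \<longleftrightarrow>
    (\<exists>U V. biclique t G U V)"
proof
  assume "\<exists>H. subgraph H (with_proj G) \<and> complete_bipartite_digraph t t H"
  then obtain H U V where H: "subgraph H (with_proj G)" "verts H = U \<union> V" "card U = t" "card V = t"
      "arcs_ends H = U \<times> V \<union> V \<times> U"
    by (auto simp: complete_bipartite_digraph_def)
  have "arcs_ends H \<subseteq> parcs G"
    using H(1) by (auto simp: subgraph_def compatible_def arcs_ends_conv)
  with H have "biclique t G U V"
    by (auto simp: biclique_def subgraph_def)
  then show "\<exists>U V. biclique t G U V" by blast
next
  interpret pair_graph G by fact
  assume "\<exists>U V. biclique t G U V"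
  then obtain U V where UV: "U \<subseteq> pverts G" "V \<subseteq> pverts G" "card U = t" "card V = t"
      "U \<times> V \<subseteq> parcs G"
    by (auto simp: biclique_def)
  have disj: "U \<inter> V = {}"
    using UV(5) pair_no_loops by fastforce
  have sub: "U \<times> V \<union> V \<times> U \<subseteq> parcs G"
    using UV(5) pair_sym_arcs by (auto simp: symmetric_def dest: symD)
  define H where "H = \<lparr>pverts = U \<union> V, parcs = U \<times> V \<union> V \<times> U\<rparr>"
  have fin: "finite U" "finite V"
    using UV(1,2) pair_finite_verts by (auto intro: finite_subset)
  interpret H: pair_graph H
    using fin disj by unfold_locales (auto simp: H_def symmetric_def sym_def)
  have "subgraph (with_proj H) (with_proj G)"
    unfolding subgraph_def
    using UV sub H.wf_digraph_axioms wf_digraph_axioms by (auto simp: H_def)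
  moreover have "complete_bipartite_digraph t t (with_proj H)"
    unfolding complete_bipartite_digraph_def
    using H.graph_axioms disj UV by (auto simp: H_def)
  ultimately show "\<exists>H. subgraph H (with_proj G) \<and> complete_bipartite_digraph t t H"
    by blast
qed

text \<open>Any \<open>t\<close> elements of \<open>Y\<close> together miss at most
  \<open>k * t\<close> elements of \<open>X\<close>, so of \<open>Suc k * t\<close> elements at
  least \<open>t\<close> are related to all of them.\<close>

lemma almost_complete_imp_complete_rectangle:
  assumes "finite X" "Suc k * t \<le> card X" "t \<le> card Y"
    and miss: "\<And>y. y \<in> Y \<Longrightarrow> card {x \<in> X. (y, x) \<notin> E} \<le> k"
  obtains U V where "U \<subseteq> Y" "V \<subseteq> X" "card U = t" "card V = t" "U \<times> V \<subseteq> E"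
proof -
  obtain U where U: "U \<subseteq> Y" "card U = t" "finite U"
    using obtain_subset_with_card_n[OF assms(3)] by metis
  define Z where "Z = (\<Union>y\<in>U. {x \<in> X. (y, x) \<notin> E})"
  have "card Z \<le> (\<Sum>y\<in>U. card {x \<in> X. (y, x) \<notin> E})"
    unfolding Z_def by (rule card_UN_le[OF U(3)])
  also have "\<dots> \<le> card U * k"
    using sum_bounded_above[of U "\<lambda>y. card {x \<in> X. (y, x) \<notin> E}" k] miss U(1) by auto
  finally have "card Z \<le> k * t"
    using U by (simp add: mult.commute)
  moreover have "card (X - Z) = card X - card Z"
    by (rule card_Diff_subset) (use assms(1) in \<open>auto simp: Z_def intro: finite_subset\<close>)
  ultimately have "t \<le> card (X - Z)"
    using assms(2) by simp
  then obtain V where V: "V \<subseteq> X - Z" "card V = t"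
    using obtain_subset_with_card_n by metis
  then have "U \<times> V \<subseteq> E"
    by (auto simp: Z_def)
  with U V that show ?thesis by blast
qed

section \<open>From flips to deletions\<close>

text \<open>This is all that the flips can see of a vertex. With at most \<open>s\<close> flips
  there are at most \<open>2 ^ s * 2 ^ s = 4 ^ s\<close> values.\<close>

definition flip_class :: "('a set \<times> 'a set) set \<Rightarrow> 'a \<Rightarrow> ('a set \<times> 'a set) set \<times> ('a set \<times> 'a set) set"
  where "flip_class \<F> v = ({F \<in> \<F>. v \<in> fst F}, {F \<in> \<F>. v \<in> snd F})"

text \<open>The parity of the number of flips that toggle a pair. The union counts a flip once even
  if both vertices lie on both of its sides. The arguments are classes, not vertices, so that a
  whole pair of classes is complemented or kept.\<close>

definition flipped_classes :: "'b set \<times> 'b set \<Rightarrow> 'b set \<times> 'b set \<Rightarrow> bool" where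
  "flipped_classes c d \<longleftrightarrow> odd (card (fst c \<inter> snd d \<union> snd c \<inter> fst d))"

text \<open>Each further flip toggles the pair exactly when it changes the parity. Distinctness of
  \<open>u\<close> and \<open>v\<close> is essential, as flips leave the diagonal alone.\<close>

lemma parcs_flips_iff:
  assumes "finite \<F>" "u \<noteq> v"
  shows "(u, v) \<in> parcs (flips \<F> G) \<longleftrightarrow>
    ((u, v) \<in> parcs G) \<noteq> flipped_classes (flip_class \<F> u) (flip_class \<F> v)"
  using assms
proof (induction \<F> rule: finite_induct)
  case empty
  then show ?case by (simp add: flip_class_def flipped_classes_def)
next
  case (insert F \<F>)
  define P where "P F \<longleftrightarrow> u \<in> fst F \<and> v \<in> snd F \<or> u \<in> snd F \<and> v \<in> fst F" for F
  have cls: "flipped_classes (flip_class \<G> u) (flip_class \<G> v) \<longleftrightarrow> odd (card {F \<in> \<G>. P F})" for \<G>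
  proof -
    have "fst (flip_class \<G> u) \<inter> snd (flip_class \<G> v) \<union> snd (flip_class \<G> u) \<inter> fst (flip_class \<G> v)
        = {F \<in> \<G>. P F}"
      by (auto simp: flip_class_def P_def)
    then show ?thesis by (simp add: flipped_classes_def)
  qed
  have "{F' \<in> insert F \<F>. P F'} = (if P F then insert F {F' \<in> \<F>. P F'} else {F' \<in> \<F>. P F'})"
    by auto
  then have card: "odd (card {F' \<in> insert F \<F>. P F'}) \<longleftrightarrow> odd (card {F' \<in> \<F>. P F'}) \<noteq> P F"
    using insert.hyps by auto
  have "(u, v) \<in> parcs (flips (insert F \<F>) G) \<longleftrightarrow> ((u, v) \<in> parcs (flips \<F> G)) \<noteq> P F"
    using insert by (auto simp: flips_insert flip_def P_def)
  then show ?case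
    using insert.IH[OF \<open>u \<noteq> v\<close>] card unfolding cls by blast
qed

lemma relpow_sym:
  assumes "sym E" "(u, v) \<in> E ^^ n"
  shows "(v, u) \<in> E ^^ n"
  using assms(2)
proof (induction n arbitrary: v)
  case (Suc n)
  then obtain w where "(u, w) \<in> E ^^ n" "(w, v) \<in> E" by auto
  with Suc.IH assms(1) show ?case
    by (metis relpow_Suc_I2 symD)
qed auto

text \<open>The radius \<open>2 * r + 2\<close> allows two walks of length \<open>r\<close> joined
  by a path of length 2. In \<open>large\<close>, the factor \<open>2 ^ (4 ^ s)\<close> pays for the
  pigeonhole over sets of classes, \<open>3 * t\<close> for the biclique argument with two misses
  per vertex, and \<open>t * 4 ^ s + m\<close> for the points lost in \<open>S\<close> and those to
  be kept.\<close>

lemma delete_small_flip_classes: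
  fixes G :: "'a pair_pre_digraph"
  assumes G: "pair_graph G" and \<F>: "finite \<F>" "card \<F> \<le> s" "\<forall>F\<in>\<F>. is_flip G F"
    and no: "\<not> (\<exists>U V. biclique t G U V)"
    and ind: "r_independent (2 * r + 2) (with_proj (flips \<F> G)) B"
    and large: "2 ^ (4 ^ s) * (3 * t + (t * 4 ^ s + m)) < card B"
  obtains S B' where "S \<subseteq> pverts G" "card S \<le> t * 4 ^ s" "B' \<subseteq> B - S" "m < card B'"
    "r_independent r (delete_verts (with_proj G) S) B'"
proof -
  interpret pair_graph G by fact
  define G' where "G' = flips \<F> G"
  define E' where "E' = parcs G'"
  have G': "pair_graph G'" and V': "pverts G' = pverts G"
    using pair_graph_flips[OF \<F>(1) G \<F>(3)] by (auto simp: G'_def)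
  interpret G': pair_graph G' by fact
  have symE: "sym (parcs G)"
    using pair_sym_arcs by (simp add: symmetric_def)
  have symE': "sym E'"
    using G'.pair_sym_arcs by (simp add: symmetric_def E'_def)
  have BV: "B \<subseteq> pverts G"
    and far: "\<And>u v n. u \<in> B \<Longrightarrow> v \<in> B \<Longrightarrow> u \<noteq> v \<Longrightarrow> n \<le> 2 * r + 2 \<Longrightarrow> (u, v) \<notin> E' ^^ n"
    using ind G' V' unfolding G'_def[symmetric] E'_def by (auto simp: r_independent_pair_iff)
  have finB: "finite B"
    using BV pair_finite_verts finite_subset by blast
  \<comment> \<open>\<open>C\<close> contains every conceivable class, whether or not a vertex
    realizes it; its size depends on the number of flips only.\<close>
  define C where "C = Pow \<F> \<times> Pow \<F>"
  have finC: "finite C" using \<F>(1) by (simp add: C_def)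
  have cardC: "card C \<le> 4 ^ s"
  proof -
    have "card C = 4 ^ card \<F>"
      using \<F>(1) by (simp add: C_def card_cartesian_product card_Pow flip: power_mult_distrib)
    then show ?thesis using \<F>(2) by (simp add: power_increasing)
  qed
  have inC: "flip_class \<F> v \<in> C" for v
    by (auto simp: C_def flip_class_def)
  define cl where "cl c = {v \<in> pverts G. flip_class \<F> v = c}" for c
  define ball where "ball b = {x. \<exists>n\<le>r. (b, x) \<in> E' ^^ n}" for b
  define S where "S = (\<Union>c\<in>{c \<in> C. card (cl c) < t}. cl c)"
  have SV: "S \<subseteq> pverts G" by (auto simp: S_def cl_def)
  have cardS: "card S \<le> t * 4 ^ s"
  proof -
    let ?D = "{c \<in> C. card (cl c) < t}"
    have "card S \<le> (\<Sum>c\<in>?D. card (cl c))"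
      unfolding S_def by (rule card_UN_le) (use finC in auto)
    also have "\<dots> \<le> card ?D * t"
      using sum_bounded_above[of ?D "\<lambda>c. card (cl c)" t] by auto
    also have "\<dots> \<le> card C * t"
      using finC by (intro mult_right_mono card_mono) auto
    also have "\<dots> \<le> 4 ^ s * t"
      using cardC by simp
    finally show ?thesis by (simp add: mult.commute)
  qed
  \<comment> \<open>The type of \<open>b\<close> is a subset of \<open>C\<close>, so some type
    \<open>T\<close> is shared by a fraction of at least \<open>1 / 2 ^ (4 ^ s)\<close> of
    \<open>B\<close>. A common type gives every ball a representative of each class in
    \<open>T\<close>.\<close>
  define type where "type b = flip_class \<F> ` ball b" for b
  obtain T where T: "card B \<le> card {b \<in> B. type b = T} * card (Pow C)"
  proof -
    have "type \<in> B \<rightarrow> Pow C" using inC by (auto simp: type_def)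
    then obtain T where "card (type -` {T} \<inter> B) * card (Pow C) \<ge> card B"
      using pigeonhole_card[of type B "Pow C"] finB finC by auto
    moreover have "type -` {T} \<inter> B = {b \<in> B. type b = T}" by auto
    ultimately show ?thesis using that by simp
  qed
  define B1 where "B1 = {b \<in> B. type b = T}"
  have B1: "B1 \<subseteq> B" "finite B1" using finB by (auto simp: B1_def)
  have cardB1: "3 * t + (t * 4 ^ s + m) < card B1"
  proof -
    have "card (Pow C) \<le> 2 ^ (4 ^ s)"
      using cardC finC by (simp add: card_Pow power_increasing)
    then have "card B1 * card (Pow C) \<le> card B1 * 2 ^ (4 ^ s)" by simp
    with T have "card B \<le> 2 ^ (4 ^ s) * card B1"
      unfolding B1_def[symmetric] by (metis mult.commute order_trans)
    with large have "2 ^ (4 ^ s) * (3 * t + (t * 4 ^ s + m)) < 2 ^ (4 ^ s) * card B1"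
      by (rule less_le_trans)
    then show ?thesis by simp
  qed
  have small: "card (cl d) < t" if "c \<in> T" "flipped_classes c d" for c d
  proof (rule ccontr)
    assume "\<not> card (cl d) < t"
    then have tY: "t \<le> card (cl d)" by simp
    have "\<exists>x. x \<in> ball b \<and> flip_class \<F> x = c" if "b \<in> B1" for b
      using that \<open>c \<in> T\<close> by (auto simp: B1_def type_def)
    then obtain x where x: "\<And>b. b \<in> B1 \<Longrightarrow> x b \<in> ball b" "\<And>b. b \<in> B1 \<Longrightarrow> flip_class \<F> (x b) = c"
      by metis
    \<comment> \<open>Used twice: \<open>k = 0\<close> makes the choice of representatives
      injective, and \<open>k = 2\<close> shows that no vertex is adjacent in \<open>E'\<close> to
      two of them.\<close>
    have near: "b = b'" if b: "b \<in> B1" "b' \<in> B1" and k: "(x b, x b') \<in> E' ^^ k" "k \<le> 2" for b b' k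
    proof (rule ccontr)
      assume "b \<noteq> b'"
      obtain i j where ij: "i \<le> r" "(b, x b) \<in> E' ^^ i" "j \<le> r" "(b', x b') \<in> E' ^^ j"
        using x(1) b unfolding ball_def by blast
      have "(b, b') \<in> E' ^^ (i + k + j)"
        using ij k(1) relpow_sym[OF symE'] unfolding relpow_add by blast
      then show False
        using far[of b b' "i + k + j"] \<open>b \<noteq> b'\<close> ij b k(2) B1(1) by auto
    qed
    have inj: "inj_on x B1"
      using near[of _ _ 0] by (auto intro!: inj_onI)
    have xV: "x ` B1 \<subseteq> pverts G"
    proof
      fix z assume "z \<in> x ` B1"
      then obtain b n where b: "b \<in> B1" "(b, z) \<in> E' ^^ n" using x(1) unfolding ball_def by blast
      then show "z \<in> pverts G"
        using BV B1(1) G'.wellformed'(2) V' by (cases n) (auto simp: E'_def)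
    qed
    have miss: "card {z \<in> x ` B1. (y, z) \<notin> parcs G} \<le> 2" if y: "y \<in> cl d" for y
    proof -
      \<comment> \<open>Between complemented classes a non-neighbour in \<open>G\<close> is a
        neighbour in \<open>E'\<close>, and there is at most one such representative. The other
        possible miss is \<open>y\<close> itself, which can be a representative when
        \<open>c = d\<close>.\<close>
      have "{z \<in> x ` B1. (y, z) \<notin> parcs G} \<subseteq> {y} \<union> {z \<in> x ` B1. (z, y) \<in> E'}"
      proof
        fix z assume "z \<in> {z \<in> x ` B1. (y, z) \<notin> parcs G}"
        then have z: "z \<in> x ` B1" "(z, y) \<notin> parcs G" "flip_class \<F> z = c"
          using x(2) symE by (auto dest: symD)
        show "z \<in> {y} \<union> {z \<in> x ` B1. (z, y) \<in> E'}"
          using z y that(1) \<open>flipped_classes c d\<close> parcs_flips_iff[OF \<F>(1), of z y G]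
          by (auto simp: cl_def E'_def G'_def)
      qed
      moreover have "card {z \<in> x ` B1. (z, y) \<in> E'} \<le> Suc 0"
      proof -
        have "z = z'" if "z \<in> x ` B1" "(z, y) \<in> E'" "z' \<in> x ` B1" "(z', y) \<in> E'" for z z'
        proof -
          have "(z, z') \<in> E' ^^ 2"
            using that symE' by (auto simp: numeral_2_eq_2 dest: symD)
          then show ?thesis using near[of _ _ 2] that by auto
        qed
        then show ?thesis
          using B1(2) by (subst card_le_Suc0_iff_eq) auto
      qed
      ultimately show ?thesis
        using B1(2) card_mono[of "{y} \<union> {z \<in> x ` B1. (z, y) \<in> E'}" "{z \<in> x ` B1. (y, z) \<notin> parcs G}"]
          card_Un_le[of "{y}" "{z \<in> x ` B1. (z, y) \<in> E'}"]
        by simp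
    qed
    obtain U V where "U \<subseteq> cl d" "V \<subseteq> x ` B1" "card U = t" "card V = t" "U \<times> V \<subseteq> parcs G"
    proof (rule almost_complete_imp_complete_rectangle[of "x ` B1" 2 t "cl d" "parcs G"])
      show "Suc 2 * t \<le> card (x ` B1)"
        using cardB1 by (simp add: card_image[OF inj])
    qed (use B1(2) tY miss in auto)
    then have "biclique t G U V"
      using xV by (auto simp: biclique_def cl_def)
    with no show False by blast
  qed
  define W where "W = pverts G - S"
  define B' where "B' = B1 - S"
  \<comment> \<open>The walk is transferred arc by arc. By induction its last but one vertex
    \<open>u\<close> lies in the ball around \<open>b\<close>, so the class of \<open>u\<close> is
    in \<open>T\<close>; the class of \<open>v\<close> has at least \<open>t\<close> vertices
    because \<open>v\<close> survived the deletion. By \<open>small\<close> the arc between them is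
    not flipped.\<close>
  have walk: "(b, v) \<in> E' ^^ n" if "b \<in> B'" "(b, v) \<in> (parcs G \<inter> W \<times> W) ^^ n" "n \<le> r" for b v n
    using that(2,3)
  proof (induction n arbitrary: v)
    case (Suc n)
    then obtain u where u: "(b, u) \<in> (parcs G \<inter> W \<times> W) ^^ n" "(u, v) \<in> parcs G" "u \<in> W" "v \<in> W"
      by auto
    have bu: "(b, u) \<in> E' ^^ n" using Suc.IH[OF u(1)] Suc.prems by simp
    then have "flip_class \<F> u \<in> type b"
      using Suc.prems(2) by (auto simp: type_def ball_def intro!: imageI exI[of _ n])
    then have uT: "flip_class \<F> u \<in> T"
      using that(1) by (auto simp: B'_def B1_def)
    have "\<not> flipped_classes (flip_class \<F> u) (flip_class \<F> v)"
    proof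
      assume "flipped_classes (flip_class \<F> u) (flip_class \<F> v)"
      then have "card (cl (flip_class \<F> v)) < t" by (rule small[OF uT])
      then have "v \<in> S"
        using u(4) inC by (auto simp: S_def W_def cl_def)
      with u(4) show False by (simp add: W_def)
    qed
    moreover have "u \<noteq> v" using pair_no_loops[OF u(2)] by simp
    ultimately have "(u, v) \<in> E'"
      using parcs_flips_iff[OF \<F>(1), of u v G] u(2) by (simp add: E'_def G'_def)
    with bu show ?case by auto
  qed simp
  have "r_independent r (delete_verts (with_proj G) S) B'"
    unfolding r_independent_delete_verts_iff[OF G] W_def[symmetric]
  proof (intro conjI ballI impI allI notI)
    show "B' \<subseteq> W" using BV B1(1) by (auto simp: B'_def W_def)
    fix u v n assume "u \<in> B'" "v \<in> B'" "u \<noteq> v" "n \<le> r" "(u, v) \<in> (parcs G \<inter> W \<times> W) ^^ n"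
    then show False
      using walk[of u v n] far[of u v n] B1(1) by (auto simp: B'_def)
  qed
  moreover have "m < card B'"
    using cardB1 cardS diff_card_le_card_Diff[of S B1] SV pair_finite_verts
    by (auto simp: B'_def dest: finite_subset)
  ultimately show ?thesis
    using that[OF SV cardS, of B'] B1(1) by (auto simp: B'_def)
qed

section \<open>From deletions to flips\<close>

text \<open>For each \<open>v\<close> in \<open>S\<close>, complementing \<open>{v}\<close> against
  its neighbours outside \<open>S\<close> erases exactly these edges. Arcs inside \<open>S\<close>
  survive, hence the restriction to \<open>u\<close> outside \<open>S\<close>; a walk that starts
  outside never reaches them.\<close>

lemma flips_isolating:
  fixes G :: "'a pair_pre_digraph"
  assumes G: "pair_graph G" and S: "S \<subseteq> pverts G"
  obtains \<F> where "finite \<F>" "card \<F> \<le> card S" "\<forall>F\<in>\<F>. is_flip G F"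
    "\<And>u v. u \<notin> S \<Longrightarrow> (u, v) \<in> parcs (flips \<F> G) \<longleftrightarrow> (u, v) \<in> parcs G \<and> v \<notin> S"
proof -
  interpret pair_graph G by fact
  have finS: "finite S" using S pair_finite_verts finite_subset by blast
  define nb where "nb v = {w. (v, w) \<in> parcs G} - S" for v
  \<comment> \<open>Neighbours inside \<open>S\<close> are left out: such an edge would be flipped from both ends.\<close>
  define \<F> where "\<F> = (\<lambda>v. ({v}, nb v)) ` S"
  have fin: "finite \<F>" using finS by (simp add: \<F>_def)
  have card: "card \<F> \<le> card S" unfolding \<F>_def by (rule card_image_le[OF finS])
  have isf: "\<forall>F\<in>\<F>. is_flip G F"
    using S by (auto simp: \<F>_def is_flip_def nb_def dest: wellformed')
  have "pair_graph (flips \<F> G)" using pair_graph_flips[OF fin G isf] by simp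
  then interpret G': pair_graph "flips \<F> G" .
  have "(u, v) \<in> parcs (flips \<F> G) \<longleftrightarrow> (u, v) \<in> parcs G \<and> v \<notin> S" if u: "u \<notin> S" for u v
  proof (cases "u = v")
    case True
    then show ?thesis using pair_no_loops[of "(u, v)"] G'.pair_no_loops[of "(u, v)"] by auto
  next
    case False
    \<comment> \<open>Since \<open>u\<close> lies outside \<open>S\<close>, it is on no first side,
      and only the flip made from \<open>v\<close> has \<open>v\<close> there. So at most one flip
      toggles the pair, and the parity is that of 0 or 1.\<close>
    have *: "fst (flip_class \<F> u) = {}" using u by (auto simp: flip_class_def \<F>_def)
    have "snd (flip_class \<F> u) \<inter> fst (flip_class \<F> v) =
        (if v \<in> S \<and> (v, u) \<in> parcs G then {({v}, nb v)} else {})"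
      using u by (auto simp: flip_class_def \<F>_def nb_def)
    then have "flipped_classes (flip_class \<F> u) (flip_class \<F> v) \<longleftrightarrow> v \<in> S \<and> (v, u) \<in> parcs G"
      by (simp add: flipped_classes_def *)
    moreover have "(v, u) \<in> parcs G \<longleftrightarrow> (u, v) \<in> parcs G"
      using pair_sym_arcs by (auto simp: symmetric_def dest: symD)
    ultimately show ?thesis
      using parcs_flips_iff[OF fin False, of G] by auto
  qed
  with fin card isf that show ?thesis by blast
qed

text \<open>A walk of the flipped graph that starts outside \<open>S\<close> never enters
  \<open>S\<close>, so it is already a walk of the graph without \<open>S\<close>, and distances
  between points of \<open>B\<close> cannot shrink.\<close>

lemma r_independent_flips_of_delete:
  fixes G :: "'a pair_pre_digraph"
  assumes G: "pair_graph G" and S: "S \<subseteq> pverts G"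
    and ind: "r_independent r (delete_verts (with_proj G) S) B"
  obtains \<F> where "finite \<F>" "card \<F> \<le> card S" "\<forall>F\<in>\<F>. is_flip G F"
    "r_independent r (with_proj (flips \<F> G)) B"
proof -
  interpret pair_graph G by fact
  obtain \<F> where \<F>: "finite \<F>" "card \<F> \<le> card S" "\<forall>F\<in>\<F>. is_flip G F"
    and arcs: "\<And>u v. u \<notin> S \<Longrightarrow> (u, v) \<in> parcs (flips \<F> G) \<longleftrightarrow> (u, v) \<in> parcs G \<and> v \<notin> S"
    using flips_isolating[OF G S] by blast
  define W where "W = pverts G - S"
  note ind' = ind[unfolded r_independent_delete_verts_iff[OF G] W_def[symmetric]]
  have walk: "v \<notin> S \<and> (u, v) \<in> (parcs G \<inter> W \<times> W) ^^ n"
    if "u \<notin> S" "(u, v) \<in> parcs (flips \<F> G) ^^ n" for u v n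
    using that(2)
  proof (induction n arbitrary: v)
    case 0
    then show ?case using that(1) by simp
  next
    case (Suc n)
    then obtain w where w: "(u, w) \<in> parcs (flips \<F> G) ^^ n" "(w, v) \<in> parcs (flips \<F> G)" by auto
    with Suc.IH arcs have "w \<notin> S" "(u, w) \<in> (parcs G \<inter> W \<times> W) ^^ n" "(w, v) \<in> parcs G" "v \<notin> S"
      by blast+
    then show ?case using wellformed' by (auto simp: W_def)
  qed
  have "pair_graph (flips \<F> G)" "pverts (flips \<F> G) = pverts G"
    using pair_graph_flips[OF \<F>(1) G \<F>(3)] by auto
  then have "r_independent r (with_proj (flips \<F> G)) B"
    using ind' walk by (auto simp: r_independent_pair_iff W_def subset_iff) blast
  with \<F> that show ?thesis by blast
qed

section \<open>The equivalence\<close>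

lemma weakly_sparse_flip_flat_imp_almost_wide:
  fixes \<C> :: "'a pair_pre_digraph set"
  assumes \<C>: "\<forall>G\<in>\<C>. pair_graph G" and "weakly_sparse \<C>" "strongly_flip_flat \<C>"
  shows "uniformly_almost_wide \<C>"
proof -
  obtain t where t: "\<And>G. G \<in> \<C> \<Longrightarrow> \<not> (\<exists>U V. biclique t G U V)"
    using assms(2) \<C> contains_complete_bipartite_iff unfolding weakly_sparse_def by metis
  obtain s :: nat where s: "\<And>r. r \<ge> 1 \<Longrightarrow> \<exists>N \<in> {1::nat..} \<rightarrow> {1::nat..}. \<forall>m\<ge>1. \<forall>G\<in>\<C>. \<forall>A\<subseteq>pverts G.
        card A \<ge> N m \<longrightarrow>
        (\<exists>\<F> B. finite \<F> \<and> card \<F> \<le> s \<and> (\<forall>F\<in>\<F>. is_flip G F) \<and>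
               B \<subseteq> A \<and> card B \<ge> m \<and> r_independent r (with_proj (flips \<F> G)) B)"
    using assms(3) unfolding strongly_flip_flat_def by blast
  show ?thesis
    unfolding uniformly_almost_wide_def
  proof (intro exI[of _ "t * 4 ^ s"] allI impI)
    fix r :: nat assume "1 \<le> r"
    \<comment> \<open>The bound \<open>s\<close> was fixed before the radius, so flip-flatness may
      be applied at radius \<open>2 * r + 2\<close> without affecting
      \<open>t * 4 ^ s\<close>.\<close>
    obtain N where N: "N \<in> {1::nat..} \<rightarrow> {1::nat..}" and flat: "\<forall>m\<ge>1. \<forall>G\<in>\<C>. \<forall>A\<subseteq>pverts G.
        card A \<ge> N m \<longrightarrow>
        (\<exists>\<F> B. finite \<F> \<and> card \<F> \<le> s \<and> (\<forall>F\<in>\<F>. is_flip G F) \<and> B \<subseteq> A \<and> card B \<ge> m \<and>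
          r_independent (2 * r + 2) (with_proj (flips \<F> G)) B)"
      using s[of "2 * r + 2"] by auto
    \<comment> \<open>The successor turns the non-strict bound on \<open>card B\<close> from
      flip-flatness into the strict premise \<open>large\<close>, and it makes \<open>M m\<close>
      positive.\<close>
    define M where "M m = Suc (2 ^ (4 ^ s) * (3 * t + (t * 4 ^ s + m)))" for m
    show "\<exists>N \<in> {1::nat..} \<rightarrow> {1::nat..}. \<forall>m\<ge>1. \<forall>G\<in>\<C>. \<forall>A\<subseteq>pverts G.
        card A \<ge> N m \<longrightarrow>
        (\<exists>S B. S \<subseteq> pverts G \<and> card S \<le> t * 4 ^ s \<and>
               B \<subseteq> A - S \<and> card B > m \<and> r_independent r (delete_verts (with_proj G) S) B)"
    proof (intro bexI[of _ "\<lambda>m. N (M m)"] allI impI ballI)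
      show "(\<lambda>m. N (M m)) \<in> {1..} \<rightarrow> {1..}" using N by (auto simp: M_def)
      fix m G A assume G: "G \<in> \<C>" and A: "A \<subseteq> pverts G" "N (M m) \<le> card A"
      moreover have "M m \<ge> 1" by (simp add: M_def)
      ultimately obtain \<F> B where \<F>: "finite \<F>" "card \<F> \<le> s" "\<forall>F\<in>\<F>. is_flip G F"
        and B: "B \<subseteq> A" "card B \<ge> M m" "r_independent (2 * r + 2) (with_proj (flips \<F> G)) B"
        using flat by metis
      have pg: "pair_graph G" using G \<C> by blast
      have "2 ^ (4 ^ s) * (3 * t + (t * 4 ^ s + m)) < card B" using B(2) by (simp add: M_def)
      then obtain S B' where "S \<subseteq> pverts G" "card S \<le> t * 4 ^ s" "B' \<subseteq> B - S" "m < card B'"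
          "r_independent r (delete_verts (with_proj G) S) B'"
        by (rule delete_small_flip_classes[OF pg \<F> t[OF G] B(3)])
      with B(1) show "\<exists>S B. S \<subseteq> pverts G \<and> card S \<le> t * 4 ^ s \<and>
               B \<subseteq> A - S \<and> card B > m \<and> r_independent r (delete_verts (with_proj G) S) B"
        by (intro exI[of _ S] exI[of _ B']) auto
    qed
  qed
qed

lemma almost_wide_imp_weakly_sparse:
  fixes \<C> :: "'a pair_pre_digraph set"
  assumes \<C>: "\<forall>G\<in>\<C>. pair_graph G" and "uniformly_almost_wide \<C>"
  shows "weakly_sparse \<C>"
proof -
  obtain s :: nat and N where wide: "\<forall>m\<ge>1. \<forall>G\<in>\<C>. \<forall>A\<subseteq>pverts G. card A \<ge> N m \<longrightarrow>
        (\<exists>S B. S \<subseteq> pverts G \<and> card S \<le> s \<and>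
               B \<subseteq> A - S \<and> card B > m \<and> r_independent 2 (delete_verts (with_proj G) S) B)"
    using assms(2) unfolding uniformly_almost_wide_def by (metis one_le_numeral)
  \<comment> \<open>The summand \<open>N 1\<close> makes the side \<open>U\<close> large enough to
    serve as \<open>A\<close>; the summand \<open>Suc s\<close> keeps \<open>S\<close> from covering
    the side \<open>V\<close>.\<close>
  define t where "t = N 1 + Suc s"
  have "\<not> biclique t G U V" if G: "G \<in> \<C>" for G U V
  proof
    assume "biclique t G U V"
    then have UV: "U \<subseteq> pverts G" "V \<subseteq> pverts G" "card U = t" "card V = t" "U \<times> V \<subseteq> parcs G"
      by (auto simp: biclique_def)
    have pg: "pair_graph G" using G \<C> by blast
    interpret pair_graph G by fact
    have "N 1 \<le> card U" using UV by (simp add: t_def)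
    then obtain S B where SB: "S \<subseteq> pverts G" "card S \<le> s" "B \<subseteq> U - S" "card B > 1"
        "r_independent 2 (delete_verts (with_proj G) S) B"
      using wide G UV(1) by (metis order_refl)
    obtain x y where xy: "x \<in> B" "y \<in> B" "x \<noteq> y"
      using SB(4) by (metis One_nat_def card_le_Suc0_iff_eq card.infinite not_less zero_le)
    \<comment> \<open>A vertex \<open>z\<close> of \<open>V\<close> outside \<open>S\<close> is a
      common neighbour of \<open>x\<close> and \<open>y\<close>, so they stay at distance at most 2,
      against independence at radius 2.\<close>
    have "\<not> V \<subseteq> S"
      using card_mono[of S V] SB(1,2) UV(4) pair_finite_verts finite_subset by (fastforce simp: t_def)
    then obtain z where z: "z \<in> V" "z \<notin> S" by blast
    let ?E = "parcs G \<inter> (pverts G - S) \<times> (pverts G - S)"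
    have "(x, z) \<in> ?E" "(y, z) \<in> ?E"
      using xy z UV SB(3) by auto
    moreover from this have "(z, y) \<in> ?E"
      using pair_sym_arcs by (auto simp: symmetric_def dest: symD)
    ultimately have "(x, y) \<in> ?E ^^ 2"
      by (auto simp: numeral_2_eq_2)
    with SB(5) xy show False
      unfolding r_independent_delete_verts_iff[OF pg] by blast
  qed
  moreover have "t \<ge> 1" by (simp add: t_def)
  ultimately show ?thesis
    using \<C> contains_complete_bipartite_iff unfolding weakly_sparse_def by metis
qed

text \<open>The same \<open>s\<close>, radius and \<open>N\<close> serve: every deleted vertex costs
  at most one flip, and more than \<open>m\<close> points are at least \<open>m\<close>.\<close>

lemma almost_wide_imp_strongly_flip_flat:
  fixes \<C> :: "'a pair_pre_digraph set"
  assumes \<C>: "\<forall>G\<in>\<C>. pair_graph G" and "uniformly_almost_wide \<C>"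
  shows "strongly_flip_flat \<C>"
proof -
  have flat: "\<exists>\<F> B. finite \<F> \<and> card \<F> \<le> s \<and> (\<forall>F\<in>\<F>. is_flip G F) \<and>
      B \<subseteq> A \<and> card B \<ge> m \<and> r_independent r (with_proj (flips \<F> G)) B"
    if "G \<in> \<C>" and del: "\<exists>S B. S \<subseteq> pverts G \<and> card S \<le> s \<and>
      B \<subseteq> A - S \<and> card B > m \<and> r_independent r (delete_verts (with_proj G) S) B"
    for s r m G and A :: "'a set"
  proof -
    obtain S B where SB: "S \<subseteq> pverts G" "card S \<le> s" "B \<subseteq> A - S" "card B > m"
        "r_independent r (delete_verts (with_proj G) S) B"
      using del by blast
    obtain \<F> where "finite \<F>" "card \<F> \<le> card S" "\<forall>F\<in>\<F>. is_flip G F"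
        "r_independent r (with_proj (flips \<F> G)) B"
      using r_independent_flips_of_delete[OF _ SB(1,5)] \<C> \<open>G \<in> \<C>\<close> by blast
    with SB show ?thesis
      by (intro exI[of _ \<F>] exI[of _ B]) auto
  qed
  obtain s :: nat where s: "\<forall>r\<ge>1. \<exists>N \<in> {1::nat..} \<rightarrow> {1::nat..}. \<forall>m\<ge>1. \<forall>G\<in>\<C>. \<forall>A\<subseteq>pverts G.
        card A \<ge> N m \<longrightarrow>
        (\<exists>S B. S \<subseteq> pverts G \<and> card S \<le> s \<and>
               B \<subseteq> A - S \<and> card B > m \<and> r_independent r (delete_verts (with_proj G) S) B)"
    using assms(2) unfolding uniformly_almost_wide_def by blast
  show ?thesis
    unfolding strongly_flip_flat_def
  proof (intro exI[of _ s] allI impI)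
    fix r :: nat assume "1 \<le> r"
    obtain N where N: "N \<in> {1::nat..} \<rightarrow> {1::nat..}" and wide: "\<forall>m\<ge>1. \<forall>G\<in>\<C>. \<forall>A\<subseteq>pverts G.
        card A \<ge> N m \<longrightarrow>
        (\<exists>S B. S \<subseteq> pverts G \<and> card S \<le> s \<and>
               B \<subseteq> A - S \<and> card B > m \<and> r_independent r (delete_verts (with_proj G) S) B)"
      by (rule bexE[OF s[THEN spec, THEN mp, OF \<open>1 \<le> r\<close>]])
    show "\<exists>N \<in> {1::nat..} \<rightarrow> {1::nat..}. \<forall>m\<ge>1. \<forall>G\<in>\<C>. \<forall>A\<subseteq>pverts G. card A \<ge> N m \<longrightarrow>
        (\<exists>\<F> B. finite \<F> \<and> card \<F> \<le> s \<and> (\<forall>F\<in>\<F>. is_flip G F) \<and>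
               B \<subseteq> A \<and> card B \<ge> m \<and> r_independent r (with_proj (flips \<F> G)) B)"
      using wide by (intro bexI[OF _ N] allI impI ballI flat) simp_all
  qed
qed

theorem mainTheorem1:
  fixes \<C> :: "'a pair_pre_digraph set"
  assumes "\<forall>G\<in>\<C>. pair_graph G"
  shows "weakly_sparse \<C> \<and> strongly_flip_flat \<C> \<longleftrightarrow> uniformly_almost_wide \<C>"
  using weakly_sparse_flip_flat_imp_almost_wide almost_wide_imp_weakly_sparse
    almost_wide_imp_strongly_flip_flat assms by blast

end
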